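(* Let $b,k,n$ be positive integers with $b\leq n$ and $k\leq n$. Then $$\gamma_{MB}(P_n^k,b)=\left\lceil \frac{n-1}{b(2k+1)-1}\right\rceil \quad\text{and}\quad \gamma_{MB}(C_n^k,b)=\left\lceil \frac{n-1}{b(2k+1)-1}\right\rceil .$$
   Context: $P_n$ is the path with vertices $v_1,\dots,v_n$ and edges $v_iv_{i+1}$ ($1\le i\le n-1$); $C_n$ is the cycle obtained by adding the edge $v_nv_1$. For a graph $G$, its $k$-th power $G^k$ has the same vertex set, with an edge between any two distinct vertices of distance at most $k$ in $G$. The $b$-biased Maker-Breaker domination game on a finite graph $G$: two players, Dominator and Staller, alternately claim previously unclaimed vertices of $G$; in each of her turns Dominator claims up to $b$ vertices, in each of his turns Staller claims one vertex. A round consists of one turn of each player. Dominator wins if the set of vertices she claims contains a dominating set of $G$ (a set $D$ such that every vertex outside $D$ has a neighbour in $D$); otherwise Staller wins. $\gamma_{MB}(G,b)$ is the smallest number of rounds within which Dominator can guarantee to win when Dominator makes the first move (both players playing optimally), and $\gamma_{MB}(G,b)=\infty$ if Staller has a winning strategy.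
   Formalization: The case n = 1 (forcing b = k = 1) is excluded: there the formula gives 0, but on a one-vertex graph Dominator needs one round since the empty set is not dominating, and C_1 would have a loop; the claim is proved for all n ≥ 2. *)

theory Defs
  imports Complex_Main "HOL-Library.Extended_Nat" "Graph_Theory.Graph_Theory"
begin

text \<open>
  A finite simple graph is a \<^locale>\<open>pair_graph\<close>: an undirected edge is represented by its two
  opposite arcs. The vertex \<open>v\<^sub>i\<close> of the path and of the cycle is the number \<open>i\<close>.
\<close>

definition path_graph :: "nat \<Rightarrow> nat pair_pre_digraph" where
  "path_graph n =
    \<lparr> pverts = {1..n},
      parcs = {(i, j). i \<in> {1..n} \<and> j \<in> {1..n} \<and> (j = i + 1 \<or> i = j + 1)} \<rparr>"

text \<open>For \<open>n = 2\<close> the added edge is already present, so the cycle is then a single edge.\<close>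

definition cycle_graph :: "nat \<Rightarrow> nat pair_pre_digraph" where
  "cycle_graph n =
    \<lparr> pverts = pverts (path_graph n),
      parcs = parcs (path_graph n) \<union> {(n, 1), (1, n)} \<rparr>"

text \<open>With unit arc costs, the library's shortest-path cost is the usual graph distance.\<close>

definition gdist :: "'a pair_pre_digraph \<Rightarrow> 'a \<Rightarrow> 'a \<Rightarrow> ereal" where
  "gdist G u v = wf_digraph.\<mu> (with_proj G) (\<lambda>_. 1) u v"

definition graph_power :: "'a pair_pre_digraph \<Rightarrow> nat \<Rightarrow> 'a pair_pre_digraph" where
  "graph_power G k =
    \<lparr> pverts = pverts G,
      parcs = {(u, v). u \<in> pverts G \<and> v \<in> pverts G \<and> u \<noteq> v \<and> gdist G u v \<le> ereal (real k)} \<rparr>"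

definition dominating_set :: "'a pair_pre_digraph \<Rightarrow> 'a set \<Rightarrow> bool" where
  "dominating_set G D \<longleftrightarrow>
    D \<subseteq> pverts G \<and> (\<forall>v \<in> pverts G - D. \<exists>u \<in> D. (v, u) \<in> parcs G)"

definition contains_dominating_set :: "'a pair_pre_digraph \<Rightarrow> 'a set \<Rightarrow> bool" where
  "contains_dominating_set G D \<longleftrightarrow> (\<exists>D' \<subseteq> D. dominating_set G D')"

text \<open>
  \<open>dominator_wins_within G b m D S\<close>: from the position in which Dominator has claimed \<open>D\<close>, Staller
  has claimed \<open>S\<close> and Dominator is to move, Dominator can force a win within \<open>m\<close> rounds. Here \<open>X\<close> is
  the set claimed in Dominator's turn and \<open>y\<close> is Staller's reply. If Dominator already wins with
  her own turn, that round counts; if instead no vertex is left for Staller to claim, the game is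
  over and Dominator has lost.
\<close>

fun dominator_wins_within ::
  "'a pair_pre_digraph \<Rightarrow> nat \<Rightarrow> nat \<Rightarrow> 'a set \<Rightarrow> 'a set \<Rightarrow> bool" where
  "dominator_wins_within G b 0 D S \<longleftrightarrow> contains_dominating_set G D"
| "dominator_wins_within G b (Suc m) D S \<longleftrightarrow>
    contains_dominating_set G D \<or>
    (\<exists>X. X \<subseteq> pverts G - (D \<union> S) \<and> card X \<le> b \<and>
      (contains_dominating_set G (D \<union> X) \<or>
       (pverts G - (D \<union> X \<union> S) \<noteq> {} \<and>
        (\<forall>y \<in> pverts G - (D \<union> X \<union> S).
           dominator_wins_within G b m (D \<union> X) (insert y S)))))"

text \<open>
  The infimum of the empty set is \<open>\<infinity>\<close>. On a finite graph the game is finite and hence determined,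
  so this is exactly the case in which Staller has a winning strategy.
\<close>

definition gamma_MB :: "'a pair_pre_digraph \<Rightarrow> nat \<Rightarrow> enat" where
  "gamma_MB G b = Inf {enat m | m. dominator_wins_within G b m {} {}}"

lemma pair_graph_path_graph: "pair_graph (path_graph n)"
proof -
  have "parcs (path_graph n) \<subseteq> {1..n} \<times> {1..n}"
    by (auto simp: path_graph_def)
  then have "finite (parcs (path_graph n))"
    by (rule finite_subset) simp
  then show ?thesis
    by unfold_locales (auto simp: path_graph_def symmetric_def sym_def)
qed

lemma pair_graph_cycle_graph:
  assumes "n \<ge> 2"
  shows "pair_graph (cycle_graph n)"
proof -
  have "parcs (cycle_graph n) \<subseteq> {1..n} \<times> {1..n}"
    using assms by (auto simp: cycle_graph_def path_graph_def)
  then have "finite (parcs (cycle_graph n))"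
    by (rule finite_subset) simp
  then show ?thesis
    using assms
    by unfold_locales (auto simp: cycle_graph_def path_graph_def symmetric_def sym_def)
qed

end

theory Submission
  imports Defs
begin

text \<open>
  Write \<open>w = b (2 k + 1) - 1\<close>. Dominator wins within \<open>m + 1\<close> rounds if \<open>n = r + m w\<close> with
  \<open>1 \<le> r \<le> w + 1\<close>: her first turn dominates the first \<open>r\<close> vertices, and the rest splits into \<open>m\<close>
  blocks of length \<open>w\<close>. Since \<open>w\<close> is one less than what \<open>b\<close> vertices can dominate, each block has two
  disjoint dominating sets of \<open>b\<close> vertices, one shifted by one against the other, so that she can
  answer every move of Staller inside the same block.

  Conversely, going round the cycle, a dominating set leaves gaps of at most \<open>2 k + 1\<close>, and the gaps
  sum up to \<open>n\<close>. Whenever the gap after some claimed \<open>d\<close> is still longer than \<open>2 k + 1\<close>, Staller takes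
  the farthest free vertex among the next \<open>2 k + 1\<close>, which shortens the final gap after \<open>d\<close> by one.
  So a round contributes at most \<open>w\<close> to the sum of the gaps, and the last round, to which Staller need
  not reply, at most \<open>w + 1\<close>.
\<close>

section \<open>Positions modulo \<open>n\<close>\<close>

text \<open>The vertex of the \<open>n\<close>-cycle at integer position \<open>x\<close>, vertex \<open>v\<close> being at position \<open>v\<close>.\<close>

definition cyc :: "nat \<Rightarrow> int \<Rightarrow> nat" where
  "cyc n x = nat ((x - 1) mod int n) + 1"

lemma cyc_in_range: "n \<ge> 1 \<Longrightarrow> cyc n x \<in> {1..n}"
  unfolding cyc_def by (auto simp: nat_less_iff Suc_le_eq)

lemma cyc_of_vertex: "v \<in> {1..n} \<Longrightarrow> cyc n (int v) = v"
  unfolding cyc_def by auto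

lemma cyc_add:
  assumes "n \<ge> 1"
  shows "cyc n (int (cyc n x) + y) = cyc n (x + y)"
proof -
  have "(int (cyc n x) + y - 1) mod int n = ((x - 1) mod int n + y) mod int n"
    using assms by (simp add: cyc_def algebra_simps)
  also have "\<dots> = (x - 1 + y) mod int n"
    by (rule mod_add_left_eq)
  also have "x - 1 + y = x + y - 1" by simp
  finally show ?thesis by (simp add: cyc_def)
qed

text \<open>The remainder differs from \<open>x - y\<close> by a multiple of \<open>n\<close>. It
  counts the steps back from \<open>x\<close> to \<open>y\<close>, so a backward search for a given
  vertex terminates.\<close>

lemma cyc_mod: "cyc n (x - (x - y) mod int n) = cyc n y"
proof -
  have "x - (x - y) mod int n - 1 = x - 1 - (x - y) mod int n" by simp
  also have "\<dots> mod int n = (x - 1 - (x - y)) mod int n" by (rule mod_diff_right_eq)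
  also have "x - 1 - (x - y) = y - 1" by simp
  finally show ?thesis by (simp only: cyc_def)
qed

section \<open>Distance and adjacency in powers of the path and the cycle\<close>

lemma gdist_eq:
  assumes "pair_wf_digraph G"
  shows "gdist G u v = (INF p\<in>{p. u \<in> pverts G \<and> set p \<subseteq> parcs G \<and> pcas u p v}. ereal (real (length p)))"
proof -
  interpret pair_wf_digraph G by fact
  have "awalk_cost (\<lambda>_. 1) p = real (length p)" for p :: "('a \<times> 'a) list"
    by (induct p) auto
  then show ?thesis unfolding gdist_def \<mu>_def awalk_def by simp
qed

lemma gdist_leE:
  assumes "pair_wf_digraph G" "gdist G u v \<le> ereal (real k)"
  obtains p where "u \<in> pverts G" "set p \<subseteq> parcs G" "pcas u p v" "length p \<le> k"
proof -
  \<comment> \<open>A strict bound yields an actual walk from the infimum; since lengths are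
    integers, length below \<open>k + 1\<close> means length at most \<open>k\<close>.\<close>
  have "gdist G u v < ereal (real k + 1)"
    using assms(2) by (rule le_less_trans) simp
  then obtain p where "u \<in> pverts G" "set p \<subseteq> parcs G" "pcas u p v" "real (length p) < real k + 1"
    unfolding gdist_eq[OF assms(1)] by (auto simp: INF_less_iff)
  then show thesis by (intro that) auto
qed

lemma gdist_leI:
  assumes "pair_wf_digraph G" "u \<in> pverts G" "set p \<subseteq> parcs G" "pcas u p v" "length p \<le> k"
  shows "gdist G u v \<le> ereal (real k)"
  unfolding gdist_eq[OF assms(1)] by (rule INF_lower2[of p]) (use assms in auto)

lemma walk_up:
  assumes "\<And>i. i \<in> {1..<n} \<Longrightarrow> (i, i + 1) \<in> A" "u \<ge> 1" "u + l \<le> n"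
  shows "\<exists>p. set p \<subseteq> A \<and> pcas u p (u + l) \<and> length p = l"
  using assms(2-)
proof (induction l arbitrary: u)
  case (Suc l)
  from Suc.IH[of "u + 1"] Suc.prems obtain p where
    "set p \<subseteq> A" "pcas (u + 1) p (u + 1 + l)" "length p = l" by auto
  then show ?case using assms(1)[of u] Suc.prems by (intro exI[of _ "(u, u + 1) # p"]) auto
qed auto

lemma walk_down:
  assumes "\<And>i. i \<in> {1..<n} \<Longrightarrow> (i + 1, i) \<in> A" "v \<ge> 1" "v + l \<le> n"
  shows "\<exists>p. set p \<subseteq> A \<and> pcas (v + l) p v \<and> length p = l"
  using assms(2-)
proof (induction l)
  case (Suc l)
  then obtain p where "set p \<subseteq> A" "pcas (v + l) p v" "length p = l" by auto
  then show ?case using assms(1)[of "v + l"] Suc.prems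
    by (intro exI[of _ "(v + l + 1, v + l) # p"]) auto
qed auto

text \<open>The arcs of the path alone supply the walk, so this serves every supergraph of the path
  on the same vertices.\<close>

lemma graph_power_near_adj:
  assumes "pair_wf_digraph G" and V: "pverts G = {1..n}"
    and up: "\<And>i. i \<in> {1..<n} \<Longrightarrow> (i, i + 1) \<in> parcs G"
    and down: "\<And>i. i \<in> {1..<n} \<Longrightarrow> (i + 1, i) \<in> parcs G"
    and uv: "u \<in> {1..n}" "v \<in> {1..n}" "u \<noteq> v" "u \<le> v + k" "v \<le> u + k"
  shows "(u, v) \<in> parcs (graph_power G k)"
proof -
  have "\<exists>p. set p \<subseteq> parcs G \<and> pcas u p v \<and> length p \<le> k"
  proof (cases "u \<le> v")
    case True
    then show ?thesis using walk_up[of n "parcs G" u "v - u", OF up] uv by fastforce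
  next
    case False
    then show ?thesis using walk_down[of n "parcs G" v "u - v", OF down] uv by fastforce
  qed
  then have "gdist G u v \<le> ereal (real k)"
    using gdist_leI[OF assms(1)] uv V by auto
  then show ?thesis using uv V by (simp add: graph_power_def)
qed

text \<open>Each arc shifts the position by at most one modulo \<open>n\<close>, and the shifts
  along a walk add up.\<close>

lemma walk_imp_offset:
  assumes "n \<ge> 1" and step: "\<And>u v. (u, v) \<in> A \<Longrightarrow> \<exists>j. \<bar>j\<bar> \<le> 1 \<and> v = cyc n (int u + j)"
    and "set p \<subseteq> A" "pcas u p v" "u \<in> {1..n}"
  shows "\<exists>j. \<bar>j\<bar> \<le> int (length p) \<and> v = cyc n (int u + j)"
  using assms(3-)
proof (induction p arbitrary: u)
  case Nil
  then show ?case by (intro exI[of _ 0]) (auto simp: cyc_of_vertex)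
next
  case (Cons e p)
  obtain w where e: "e = (u, w)" using Cons.prems by (cases e) auto
  then obtain j where j: "\<bar>j\<bar> \<le> 1" "w = cyc n (int u + j)" using Cons.prems step by auto
  moreover have "w \<in> {1..n}" using j cyc_in_range \<open>n \<ge> 1\<close> by blast
  then obtain j' where "\<bar>j'\<bar> \<le> int (length p)" "v = cyc n (int w + j')"
    using Cons.IH[of w] Cons.prems e by auto
  ultimately show ?case
    using \<open>n \<ge> 1\<close> by (intro exI[of _ "j + j'"]) (auto simp: cyc_add add.assoc)
qed

lemma graph_power_adj_imp_offset:
  assumes "pair_wf_digraph G" "pverts G = {1..n}"
    and "\<And>u v. (u, v) \<in> parcs G \<Longrightarrow> \<exists>j. \<bar>j\<bar> \<le> 1 \<and> v = cyc n (int u + j)"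
    and "(u, v) \<in> parcs (graph_power G k)"
  shows "\<exists>j. \<bar>j\<bar> \<le> int k \<and> v = cyc n (int u + j)"
proof -
  have u: "u \<in> {1..n}" and "gdist G u v \<le> ereal (real k)"
    using assms by (auto simp: graph_power_def)
  with gdist_leE[OF assms(1)] obtain p where p: "set p \<subseteq> parcs G" "pcas u p v" "length p \<le> k"
    by blast
  have "n \<ge> 1" using u by auto
  have "\<exists>j. \<bar>j\<bar> \<le> int (length p) \<and> v = cyc n (int u + j)"
    by (rule walk_imp_offset[OF \<open>n \<ge> 1\<close> _ p(1,2) u]) (rule assms(3))
  with p(3) show ?thesis by (metis of_nat_mono order_trans)
qed

section \<open>Coverage and gaps around the cycle\<close>

text \<open>Offset \<open>j = 0\<close> stands for membership. Wrapping round is allowed even when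
  the graph is a path, so coverage is only a necessary condition for domination there, which is
  enough for the lower bound.\<close>

definition cyc_covers :: "nat \<Rightarrow> nat \<Rightarrow> nat set \<Rightarrow> nat \<Rightarrow> bool" where
  "cyc_covers n k D v \<longleftrightarrow> (\<exists>j. \<bar>j\<bar> \<le> int k \<and> cyc n (int v + j) \<in> D)"

text \<open>These are the lengths that the gap after \<open>d\<close> can still end up with: the
  vertex that closes it must not be Staller's and no vertex of \<open>D\<close> may close it
  earlier. A gap beyond \<open>2 * k + 1\<close> would leave the vertex \<open>k + 1\<close> steps
  after \<open>d\<close> uncovered.\<close>

definition reach_set :: "nat \<Rightarrow> nat \<Rightarrow> nat set \<Rightarrow> nat set \<Rightarrow> nat \<Rightarrow> nat set" where
  "reach_set n k D S d =
    {j \<in> {1..2 * k + 1}. cyc n (int d + int j) \<notin> S \<and> (\<forall>i \<in> {1..<j}. cyc n (int d + int i) \<notin> D)}"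

text \<open>
  An upper bound for the final gap after \<open>d\<close>, exact if the next vertex of \<open>D\<close> is at most \<open>2 k + 1\<close>
  steps away.
\<close>

definition reach :: "nat \<Rightarrow> nat \<Rightarrow> nat set \<Rightarrow> nat set \<Rightarrow> nat \<Rightarrow> nat" where
  "reach n k D S d = Max (insert 0 (reach_set n k D S d))"

lemma finite_reach_set [simp]: "finite (reach_set n k D S d)"
  by (simp add: reach_set_def)

lemma reach_le: "reach n k D S d \<le> 2 * k + 1"
  unfolding reach_def by (subst Max_le_iff) (auto simp: reach_set_def)

lemma reach_ge: "j \<in> reach_set n k D S d \<Longrightarrow> j \<le> reach n k D S d"
  unfolding reach_def by (rule Max_ge) auto

text \<open>Enlarging \<open>D\<close> only closes gaps earlier, and enlarging \<open>S\<close> only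
  forbids more ends.\<close>

lemma reach_antimono:
  assumes "D \<subseteq> D'" "S \<subseteq> S'"
  shows "reach n k D' S' d \<le> reach n k D S d"
  unfolding reach_def using assms by (intro Max_mono) (auto simp: reach_set_def)

lemma ex_predecessor:
  assumes "D \<noteq> {}" "D \<subseteq> {1..n}" "v \<in> {1..n}"
  obtains d i where "d \<in> D" "cyc n (int d + int i) = v"
    "\<forall>i' \<in> {1..i}. cyc n (int d + int i') \<notin> D"
proof -
  have n: "n \<ge> 1" using assms by auto
  let ?P = "\<lambda>i::nat. cyc n (int v - int i) \<in> D"
  obtain x where x: "x \<in> D" using assms by auto
  \<comment> \<open>Going back from \<open>v\<close> meets any chosen \<open>x\<close> of
    \<open>D\<close> within one turn of the cycle; the least number of steps then gives the nearest
    predecessor.\<close>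
  have "?P (nat ((int v - int x) mod int n))"
    using n x assms cyc_mod[of n "int v" "int x"] by (auto simp: cyc_of_vertex subset_iff)
  then have P: "?P (LEAST i. ?P i)" by (rule LeastI)
  define i where "i = (LEAST i. ?P i)"
  define d where "d = cyc n (int v - int i)"
  have eq: "cyc n (int d + y) = cyc n (int v - int i + y)" for y
    unfolding d_def by (rule cyc_add[OF n])
  show thesis
  proof (rule that[of d i])
    show "d \<in> D" using P by (simp add: d_def i_def)
    show "cyc n (int d + int i) = v" using assms by (simp add: eq cyc_of_vertex)
    show "\<forall>i' \<in> {1..i}. cyc n (int d + int i') \<notin> D"
    proof
      fix i' assume i': "i' \<in> {1..i}"
      then have "i - i' < i" by auto
      then have "\<not> ?P (i - i')" unfolding i_def by (rule not_less_Least)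
      moreover have "int v - int (i - i') = int v - int i + int i'" using i' by auto
      ultimately show "cyc n (int d + int i') \<notin> D" unfolding eq by metis
    qed
  qed
qed

text \<open>The window of radius \<open>k\<close> around position \<open>d + k + 1\<close> is
  exactly the next \<open>2 * k + 1\<close> positions after \<open>d\<close>.\<close>

lemma cyc_covers_forward:
  assumes "n \<ge> 1" "cyc_covers n k D (cyc n (int d + int k + 1))"
  obtains g where "g \<in> {1..2 * k + 1}" "cyc n (int d + int g) \<in> D"
proof -
  obtain j where j: "\<bar>j\<bar> \<le> int k" "cyc n (int d + int k + 1 + j) \<in> D"
    using assms by (auto simp: cyc_covers_def cyc_add)
  show thesis
    by (rule that[of "nat (int k + 1 + j)"]) (use j in \<open>auto simp: algebra_simps\<close>)
qed

lemma covered_imp_sum_reach_ge: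
  assumes "D \<noteq> {}" "D \<subseteq> {1..n}" "D \<inter> S = {}"
    and cov: "\<forall>v \<in> {1..n}. cyc_covers n k D v"
  shows "n \<le> (\<Sum>d\<in>D. reach n k D S d)"
proof -
  have n: "n \<ge> 1" using assms by auto
  have fin: "finite D" using assms by (auto intro: finite_subset)
  let ?arc = "\<lambda>d. (\<lambda>i. cyc n (int d + int i)) ` {..<reach n k D S d}"
  \<comment> \<open>Half-open arcs, each starting at a vertex of \<open>D\<close> and at least as
    long as the gap after it, cover the whole cycle.\<close>
  have "{1..n} \<subseteq> (\<Union>d\<in>D. ?arc d)"
  proof
    fix v assume v: "v \<in> {1..n}"
    obtain d i where d: "d \<in> D" "cyc n (int d + int i) = v"
      "\<forall>i' \<in> {1..i}. cyc n (int d + int i') \<notin> D"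
      by (rule ex_predecessor[OF assms(1,2) v])
    let ?Q = "\<lambda>g. g \<in> {1..2 * k + 1} \<and> cyc n (int d + int g) \<in> D"
    have "cyc_covers n k D (cyc n (int d + int k + 1))" using cov cyc_in_range[OF n] by blast
    then obtain g0 where "?Q g0" by (rule cyc_covers_forward[OF n]) blast
    then have Q: "?Q (LEAST g. ?Q g)" by (rule LeastI)
    define g where "g = (LEAST g. ?Q g)"
    have less: "\<not> ?Q g'" if "g' < g" for g'
      using that not_less_Least unfolding g_def by blast
    have Qg: "?Q g" using Q by (simp add: g_def)
    have "g \<in> reach_set n k D S d"
      using Qg less assms by (fastforce simp: reach_set_def)
    then have "g \<le> reach n k D S d" by (rule reach_ge)
    moreover have "i < g" using Qg d(3) by force
    ultimately show "v \<in> (\<Union>d\<in>D. ?arc d)" using d by force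
  qed
  then have "card {1..n} \<le> card (\<Union>d\<in>D. ?arc d)"
    by (intro card_mono) (use fin in auto)
  also have "\<dots> \<le> (\<Sum>d\<in>D. card (?arc d))" by (rule card_UN_le[OF fin])
  also have "\<dots> \<le> (\<Sum>d\<in>D. reach n k D S d)"
    by (intro sum_mono) (use card_image_le in force)
  finally show ?thesis by simp
qed

text \<open>The predecessor \<open>d\<close> of an uncovered vertex has no vertex of
  \<open>D\<close> within \<open>2 * k + 1\<close> steps, so claiming the end of its longest
  possible gap lowers its \<open>reach\<close>. The set \<open>D'\<close>, a completion that avoids
  \<open>S\<close>, guarantees that such an end exists.\<close>

lemma staller_move:
  assumes "D \<noteq> {}" "D \<subseteq> {1..n}"
    and v: "v \<in> {1..n}" "\<not> cyc_covers n k D v"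
    and D': "D \<subseteq> D'" "D' \<inter> S = {}" "\<forall>u \<in> {1..n}. cyc_covers n k D' u"
  obtains y where "y \<in> {1..n} - (D \<union> S)"
    "(\<Sum>d\<in>D. reach n k D (insert y S) d) < (\<Sum>d\<in>D. reach n k D S d)"
proof -
  have n: "n \<ge> 1" using assms by auto
  have fin: "finite D" using assms by (auto intro: finite_subset)
  obtain d i where d: "d \<in> D" "cyc n (int d + int i) = v"
    "\<forall>i' \<in> {1..i}. cyc n (int d + int i') \<notin> D"
    by (rule ex_predecessor[OF assms(1,2) v(1)])
  have near: "cyc n (int d + int i + j) \<notin> D" if "\<bar>j\<bar> \<le> int k" for j
    using v(2) that unfolding cyc_covers_def d(2)[symmetric] cyc_add[OF n] by blast
  \<comment> \<open>Otherwise \<open>d\<close> itself would cover \<open>v\<close>.\<close>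
  have "k < i"
  proof (rule ccontr)
    assume "\<not> k < i"
    then have "cyc n (int d) \<notin> D" using near[of "- int i"] by auto
    then show False using d assms by (auto simp: cyc_of_vertex subset_iff)
  qed
  \<comment> \<open>Up to \<open>v\<close> this is the choice of \<open>d\<close>; beyond
    \<open>v\<close> the distance is at most \<open>2 * k + 1 - i\<close>, hence at most
    \<open>k\<close>, and \<open>v\<close> is uncovered.\<close>
  have free: "cyc n (int d + int g) \<notin> D" if "g \<in> {1..2 * k + 1}" for g
  proof (cases "g \<le> i")
    case True
    then show ?thesis using d(3) that by auto
  next
    case False
    then show ?thesis using near[of "int g - int i"] that \<open>k < i\<close> by auto
  qed
  have "cyc_covers n k D' (cyc n (int d + int k + 1))" using D'(3) cyc_in_range[OF n] by blast
  then obtain g where g: "g \<in> {1..2 * k + 1}" "cyc n (int d + int g) \<in> D'"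
    by (rule cyc_covers_forward[OF n])
  have "g \<in> reach_set n k D S d"
    using g free D' by (auto simp: reach_set_def)
  \<comment> \<open>This excludes the default value \<open>0\<close> of \<open>reach\<close>, which
    could not be lowered.\<close>
  then have pos: "1 \<le> reach n k D S d" using reach_ge g(1) by fastforce
  define a where "a = reach n k D S d"
  have "a \<in> insert 0 (reach_set n k D S d)"
    unfolding a_def reach_def by (rule Max_in) auto
  then have a: "a \<in> reach_set n k D S d" using pos a_def by auto
  define y where "y = cyc n (int d + int a)"
  \<comment> \<open>Staller's move removes the maximum \<open>a\<close> from the set, so the new
    maximum is strictly smaller.\<close>
  have "reach_set n k D (insert y S) d \<subseteq> {j \<in> reach_set n k D S d. j \<noteq> a}"
    by (auto simp: reach_set_def y_def)
  then have "reach n k D (insert y S) d < a"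
    using pos unfolding reach_def[of n k D "insert y S"]
    by (subst Max_less_iff) (use reach_ge[of _ n k D S d] in \<open>force simp: a_def\<close>)+
  then have "(\<Sum>d\<in>D. reach n k D (insert y S) d) < (\<Sum>d\<in>D. reach n k D S d)"
    by (intro sum_strict_mono_ex1[OF fin]) (use d(1) in \<open>auto simp: a_def intro!: reach_antimono bexI[of _ d]\<close>)
  moreover have "y \<in> {1..n} - (D \<union> S)"
    using a free cyc_in_range[OF n] unfolding y_def by (auto simp: reach_set_def)
  ultimately show thesis by (rule that[rotated])
qed

section \<open>Lower bound on the number of rounds\<close>

lemma contains_dominating_set_iff:
  assumes "D \<subseteq> pverts G"
  shows "contains_dominating_set G D \<longleftrightarrow> (\<forall>v \<in> pverts G. v \<in> D \<or> (\<exists>u \<in> D. (v, u) \<in> parcs G))"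
  using assms unfolding contains_dominating_set_def dominating_set_def by blast

text \<open>Following a winning strategy against arbitrary replies ends in such a set. It provides
  the \<open>D'\<close> of \<open>staller_move\<close>.\<close>

lemma dominator_wins_within_imp_completion:
  assumes "dominator_wins_within G b m D S" "D \<inter> S = {}" "D \<subseteq> pverts G"
  shows "\<exists>D'. D \<subseteq> D' \<and> D' \<inter> S = {} \<and> D' \<subseteq> pverts G \<and> contains_dominating_set G D'"
  using assms
proof (induction m arbitrary: D S)
  case 0
  then show ?case by auto
next
  case (Suc m)
  show ?case
  proof (cases "contains_dominating_set G D")
    case False
    with Suc.prems obtain X where X: "X \<subseteq> pverts G - (D \<union> S)"
      and *: "contains_dominating_set G (D \<union> X) \<or>
       (pverts G - (D \<union> X \<union> S) \<noteq> {} \<and>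
        (\<forall>y \<in> pverts G - (D \<union> X \<union> S).
           dominator_wins_within G b m (D \<union> X) (insert y S)))" by auto
    show ?thesis
    proof (cases "contains_dominating_set G (D \<union> X)")
      case True
      then show ?thesis using X Suc.prems by (intro exI[of _ "D \<union> X"]) auto
    next
      case False
      with * obtain y where y: "y \<in> pverts G - (D \<union> X \<union> S)"
        "dominator_wins_within G b m (D \<union> X) (insert y S)" by blast
      have "(D \<union> X) \<inter> insert y S = {}" "D \<union> X \<subseteq> pverts G"
        using X Suc.prems(2,3) y(1) by auto
      from Suc.IH[OF y(2) this] obtain D' where "D \<union> X \<subseteq> D' \<and> D' \<inter> insert y S = {} \<and>
        D' \<subseteq> pverts G \<and> contains_dominating_set G D'" by (rule exE)
      then show ?thesis by (intro exI[of _ D']) auto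
    qed
  qed (use Suc.prems in auto)
qed

text \<open>Induction on the rounds left: new vertices add at most \<open>b * (2 * k + 1)\<close>,
  old gaps do not grow, and Staller's reply takes one off. The final \<open>+ 1\<close> pays for the
  round without a useful reply. From empty sets the sum vanishes.\<close>

lemma dominator_wins_within_imp_le:
  assumes V: "pverts G = {1..n}" and "n \<ge> 1" "b \<ge> 1"
    and adj: "\<And>u v. (u, v) \<in> parcs G \<Longrightarrow> \<exists>j. \<bar>j\<bar> \<le> int k \<and> v = cyc n (int u + j)"
    and "dominator_wins_within G b m D S" "D \<subseteq> {1..n}" "D \<inter> S = {}"
  shows "n \<le> (\<Sum>d\<in>D. reach n k D S d) + m * (b * (2 * k + 1) - 1) + 1"
proof -
  have covers: "\<forall>v \<in> {1..n}. cyc_covers n k D v"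
    if "contains_dominating_set G D" "D \<subseteq> {1..n}" for D
  proof
    fix v assume v: "v \<in> {1..n}"
    have "v \<in> D \<or> (\<exists>u \<in> D. (v, u) \<in> parcs G)"
      using that v V contains_dominating_set_iff[of D G] by auto
    then consider "v \<in> D" | u where "u \<in> D" "(v, u) \<in> parcs G" by blast
    then show "cyc_covers n k D v"
    proof cases
      case 1
      then show ?thesis using v by (auto simp: cyc_covers_def cyc_of_vertex intro!: exI[of _ 0])
    next
      case 2
      then show ?thesis using adj by (auto simp: cyc_covers_def)
    qed
  qed
  have sum_ge: "n \<le> (\<Sum>d\<in>D. reach n k D S d)"
    if "\<forall>v \<in> {1..n}. cyc_covers n k D v" "D \<subseteq> {1..n}" "D \<inter> S = {}" for D S
  proof (rule covered_imp_sum_reach_ge)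
    show "D \<noteq> {}" using that(1) \<open>n \<ge> 1\<close> by (force simp: cyc_covers_def)
  qed (use that in auto)
  show ?thesis
    using assms(5-)
  proof (induction m arbitrary: D S)
    case 0
    then show ?case using sum_ge[of D S] covers[of D] by auto
  next
    case (Suc m)
    show ?case
    proof (cases "contains_dominating_set G D")
      case True
      then show ?thesis using sum_ge[of D S] covers[of D] Suc.prems by auto
    next
      case False
      with Suc.prems V obtain X where X: "X \<subseteq> {1..n} - (D \<union> S)" "card X \<le> b"
        and *: "contains_dominating_set G (D \<union> X) \<or>
         ({1..n} - (D \<union> X \<union> S) \<noteq> {} \<and>
          (\<forall>y \<in> {1..n} - (D \<union> X \<union> S).
             dominator_wins_within G b m (D \<union> X) (insert y S)))" by auto
      let ?E = "D \<union> X"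
      have fin: "finite D" "finite X" using X Suc.prems by (auto intro: finite_subset)
      have E: "?E \<subseteq> {1..n}" "?E \<inter> S = {}" using X Suc.prems by auto
      have "(\<Sum>d\<in>?E. reach n k ?E S d) = (\<Sum>d\<in>D. reach n k ?E S d) + (\<Sum>d\<in>X. reach n k ?E S d)"
        using fin X by (intro sum.union_disjoint) auto
      also have "(\<Sum>d\<in>D. reach n k ?E S d) \<le> (\<Sum>d\<in>D. reach n k D S d)"
        by (intro sum_mono reach_antimono) auto
      also have "(\<Sum>d\<in>X. reach n k ?E S d) \<le> card X * (2 * k + 1)"
        using sum_bounded_above[of X "reach n k ?E S" "2 * k + 1"] reach_le by auto
      also have "\<dots> \<le> b * (2 * k + 1)" using X by (intro mult_right_mono) auto
      finally have sumE: "(\<Sum>d\<in>?E. reach n k ?E S d) \<le> (\<Sum>d\<in>D. reach n k D S d) + b * (2 * k + 1)"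
        by simp
      have pos: "b * (2 * k + 1) \<ge> 1" using \<open>b \<ge> 1\<close> by simp
      \<comment> \<open>The split is on cyclic coverage, not on winning: on a path the former may
        come first, and then the gaps already sum to \<open>n\<close>, while Staller's move needs an
        uncovered vertex.\<close>
      show ?thesis
      proof (cases "\<forall>v \<in> {1..n}. cyc_covers n k ?E v")
        case True
        then show ?thesis using sum_ge[OF True E] sumE pos by simp
      next
        case False
        with * covers E have **: "{1..n} - (?E \<union> S) \<noteq> {}"
          "\<And>y. y \<in> {1..n} - (?E \<union> S) \<Longrightarrow> dominator_wins_within G b m ?E (insert y S)"
          by blast+
        \<comment> \<open>If Dominator has claimed nothing, the sum is empty and any reply will
          do.\<close>
        obtain y where y: "y \<in> {1..n} - (?E \<union> S)"
          "(\<Sum>d\<in>?E. reach n k ?E (insert y S) d) \<le> (\<Sum>d\<in>D. reach n k D S d) + (b * (2 * k + 1) - 1)"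
        proof (cases "?E = {}")
          case True
          then show ?thesis using that **(1) by fastforce
        next
          case nonempty: False
          \<comment> \<open>An arbitrary reply \<open>y0\<close> serves only to obtain a completion
            avoiding \<open>S\<close>; the reply actually made is the \<open>y\<close> of
            \<open>staller_move\<close>.\<close>
          obtain y0 where y0: "y0 \<in> {1..n} - (?E \<union> S)" using ** by blast
          obtain D' where D': "?E \<subseteq> D'" "D' \<inter> insert y0 S = {}" "D' \<subseteq> {1..n}" "contains_dominating_set G D'"
            using dominator_wins_within_imp_completion[OF **(2)[OF y0]] E y0 V by auto
          obtain v where v: "v \<in> {1..n}" "\<not> cyc_covers n k ?E v" using False by blast
          obtain y where "y \<in> {1..n} - (?E \<union> S)"
            "(\<Sum>d\<in>?E. reach n k ?E (insert y S) d) < (\<Sum>d\<in>?E. reach n k ?E S d)"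
            using staller_move[OF nonempty E(1) v D'(1), of S] D' covers[of D'] by auto
          then show ?thesis using that[of y] sumE by linarith
        qed
        have "n \<le> (\<Sum>d\<in>?E. reach n k ?E (insert y S) d) + m * (b * (2 * k + 1) - 1) + 1"
          using Suc.IH[OF **(2)[OF y(1)]] E y by auto
        then show ?thesis using y(2) by simp
      qed
    qed
  qed
qed

section \<open>Dominator's strategy on blocks\<close>

text \<open>Invariant: \<open>J\<close> indexes the unfinished blocks, everything outside them is
  dominated, and Staller holds at most the vertex \<open>y\<close> inside them. One turn finishes
  one block.\<close>

lemma dominator_wins_blocks:
  assumes "finite J" "card J \<le> m"
    and disj: "disjoint_family_on B J"
    and blocks: "\<And>j. j \<in> J \<Longrightarrow> B j \<subseteq> pverts G \<and> B j \<noteq> {} \<and>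
      (\<exists>X Y. X \<subseteq> B j \<and> Y \<subseteq> B j \<and> X \<inter> Y = {} \<and> card X \<le> b \<and> card Y \<le> b \<and>
        (\<forall>v \<in> B j. v \<in> X \<or> (\<exists>u \<in> X. (v, u) \<in> parcs G)) \<and>
        (\<forall>v \<in> B j. v \<in> Y \<or> (\<exists>u \<in> Y. (v, u) \<in> parcs G)))"
    and "D \<subseteq> pverts G" "D \<inter> (\<Union>j\<in>J. B j) = {}" "S \<inter> (\<Union>j\<in>J. B j) \<subseteq> {y}"
    and dom: "\<And>v. v \<in> pverts G \<Longrightarrow> v \<notin> (\<Union>j\<in>J. B j) \<Longrightarrow> v \<in> D \<or> (\<exists>u \<in> D. (v, u) \<in> parcs G)"
  shows "dominator_wins_within G b m D S"
  using assms
proof (induction m arbitrary: J D S y)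
  case 0
  then show ?case by (auto simp: contains_dominating_set_iff)
next
  case (Suc m)
  show ?case
  proof (cases "J = {}")
    case True
    then show ?thesis using Suc.prems by (simp add: contains_dominating_set_iff)
  next
    case False
    \<comment> \<open>The block that Staller has just entered is taken, or any block if he entered
      none. Of the two disjoint dominating sets, at least one misses \<open>y\<close>.\<close>
    obtain j where j: "j \<in> J" "y \<in> (\<Union>j\<in>J. B j) \<Longrightarrow> y \<in> B j"
      using False by blast
    obtain X where X: "X \<subseteq> B j" "card X \<le> b" "y \<notin> X"
        "\<forall>v \<in> B j. v \<in> X \<or> (\<exists>u \<in> X. (v, u) \<in> parcs G)"
      using Suc.prems(4)[OF j(1)] by (metis disjoint_iff)
    let ?J = "J - {j}"
    define U where "U = (\<Union>j\<in>?J. B j)"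
    have U: "(\<Union>j\<in>J. B j) = B j \<union> U" using j(1) unfolding U_def by blast
    have Bj: "B j \<inter> U = {}"
      using Suc.prems(3) j(1) unfolding U_def by (auto simp: disjoint_family_on_def)
    have BV: "B j \<subseteq> pverts G" using Suc.prems(4)[OF j(1)] by (rule conjunct1)
    have D: "D \<inter> B j = {}" "D \<inter> U = {}" and S: "S \<inter> B j \<subseteq> {y}" "S \<inter> U \<subseteq> {y}"
      using Suc.prems(6,7) unfolding U by blast+
    have XV: "X \<subseteq> pverts G - (D \<union> S)" using X(1,3) D(1) S(1) BV by blast
    have dom: "v \<in> D \<union> X \<or> (\<exists>u \<in> D \<union> X. (v, u) \<in> parcs G)"
      if "v \<in> pverts G" "v \<notin> U" for v
    proof (cases "v \<in> B j")
      case True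
      then show ?thesis using X(4) by blast
    next
      case False
      then show ?thesis using that Suc.prems(8)[of v] unfolding U by blast
    qed
    have SU: "S \<inter> U = {}"
    proof (rule ccontr)
      assume "S \<inter> U \<noteq> {}"
      then have "y \<in> U" using S(2) by blast
      then show False using j(2) Bj unfolding U by blast
    qed
    have step: "dominator_wins_within G b m (D \<union> X) (insert z S)" for z
    proof (rule Suc.IH[of ?J _ _ z])
      show "finite ?J" using Suc.prems(1) by simp
      show "card ?J \<le> m" using Suc.prems(2) j(1) by (simp add: card_Diff_singleton)
      show "disjoint_family_on B ?J" using Suc.prems(3) by (auto simp: disjoint_family_on_def)
      show "D \<union> X \<subseteq> pverts G" using Suc.prems(5) XV by blast
      show "(D \<union> X) \<inter> (\<Union>j\<in>?J. B j) = {}" using D(2) X(1) Bj unfolding U_def[symmetric] by blast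
      show "insert z S \<inter> (\<Union>j\<in>?J. B j) \<subseteq> {z}" using SU unfolding U_def[symmetric] by blast
      show "v \<in> D \<union> X \<or> (\<exists>u \<in> D \<union> X. (v, u) \<in> parcs G)"
        if "v \<in> pverts G" "v \<notin> (\<Union>j\<in>?J. B j)" for v
        using dom that unfolding U_def[symmetric] .
    next
      fix i assume "i \<in> ?J"
      then show "B i \<subseteq> pverts G \<and> B i \<noteq> {} \<and>
        (\<exists>X Y. X \<subseteq> B i \<and> Y \<subseteq> B i \<and> X \<inter> Y = {} \<and> card X \<le> b \<and> card Y \<le> b \<and>
          (\<forall>v \<in> B i. v \<in> X \<or> (\<exists>u \<in> X. (v, u) \<in> parcs G)) \<and>
          (\<forall>v \<in> B i. v \<in> Y \<or> (\<exists>u \<in> Y. (v, u) \<in> parcs G)))"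
        by (intro Suc.prems(4)) simp
    qed
    show ?thesis
    proof (cases "?J = {}")
      case True
      have "U = {}" unfolding U_def True by simp
      then have "contains_dominating_set G (D \<union> X)"
        using dom Suc.prems(5) XV by (subst contains_dominating_set_iff) auto
      then show ?thesis using XV X(2) by auto
    next
      case False
      \<comment> \<open>A further block leaves Staller a vertex to claim, so the game is not
        over.\<close>
      then obtain i where i: "i \<in> ?J" by blast
      obtain x where "x \<in> B i" "x \<in> pverts G" using Suc.prems(4)[of i] i by blast
      then have "x \<in> U" "x \<in> pverts G" using i unfolding U_def by blast+
      then have "x \<in> pverts G - (D \<union> X \<union> S)" using D(2) SU Bj X(1) by blast
      then have "pverts G - (D \<union> X \<union> S) \<noteq> {}" by blast
      then show ?thesis using step XV X(2) by auto
    qed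
  qed
qed

text \<open>Centres are spaced \<open>2 * k + 1\<close> apart from \<open>c\<close> on. The bound
  \<open>c \<le> k + 1\<close> takes care of the left end, and the inequality on \<open>w\<close>
  says that the last centre reaches the right end. Clamping at \<open>w\<close> keeps centres inside
  without losing any vertex of the interval.\<close>

lemma centres_dominate:
  assumes V: "pverts G = {1..n}"
    and near: "\<And>u v. u \<in> {1..n} \<Longrightarrow> v \<in> {1..n} \<Longrightarrow> u \<noteq> v \<Longrightarrow> u \<le> v + k \<Longrightarrow> v \<le> u + k \<Longrightarrow>
      (u, v) \<in> parcs G"
    and c: "1 \<le> c" "c \<le> k + 1" and w: "w \<ge> 1" "l + w \<le> n" "w + k < c + b * (2 * k + 1)"
  defines "X \<equiv> (\<lambda>i. l + min w (c + i * (2 * k + 1))) ` {..<b}"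
  shows "X \<subseteq> {l + 1..l + w}" "card X \<le> b"
    "\<forall>v \<in> {l + 1..l + w}. v \<in> X \<or> (\<exists>u \<in> X. (v, u) \<in> parcs G)"
proof -
  show sub: "X \<subseteq> {l + 1..l + w}" using c w by (auto simp: X_def)
  show "card X \<le> b" unfolding X_def using card_image_le[of "{..<b}"] by force
  show "\<forall>v \<in> {l + 1..l + w}. v \<in> X \<or> (\<exists>u \<in> X. (v, u) \<in> parcs G)"
  proof
    fix v assume v: "v \<in> {l + 1..l + w}"
    define t where "t = v - l"
    have t: "1 \<le> t" "t \<le> w" "v = l + t" using v by (auto simp: t_def)
    define q where "q = 2 * k + 1"
    \<comment> \<open>The windows of radius \<open>k\<close> around the unclamped centres are
      consecutive, starting at \<open>c - k\<close>, so division finds the one containing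
      \<open>t\<close>. The subtraction is not truncated, as
      \<open>c \<le> k + 1 \<le> t + k\<close>.\<close>
    define i where "i = (t + k - c) div q"
    have "q > 0" by (simp add: q_def)
    have "t + k - c < b * q" using t w c by (auto simp: q_def)
    then have i: "i < b" unfolding i_def using \<open>q > 0\<close> by (simp add: less_mult_imp_div_less)
    have "i * q \<le> t + k - c" unfolding i_def by (rule div_times_less_eq_dividend)
    moreover have "t + k - c < i * q + q"
      unfolding i_def using \<open>q > 0\<close> dividend_less_div_times by (metis add.commute)
    ultimately have iq: "c + i * q \<le> t + k" "t \<le> c + i * q + k" using t c by (auto simp: q_def)
    define u where "u = l + min w (c + i * q)"
    have u: "u \<in> X" unfolding u_def X_def q_def using i by blast
    have "u \<le> v + k" "v \<le> u + k" using iq t unfolding u_def by auto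
    then show "v \<in> X \<or> (\<exists>u \<in> X. (v, u) \<in> parcs G)"
      using near[of v u] u sub v w by (cases "u = v") fastforce+
  qed
qed

lemma dominator_wins_interval:
  assumes V: "pverts G = {1..n}"
    and near: "\<And>u v. u \<in> {1..n} \<Longrightarrow> v \<in> {1..n} \<Longrightarrow> u \<noteq> v \<Longrightarrow> u \<le> v + k \<Longrightarrow> v \<le> u + k \<Longrightarrow>
      (u, v) \<in> parcs G"
    and "k \<ge> 1" "b \<ge> 1"
  defines "w \<equiv> b * (2 * k + 1) - 1"
  assumes n: "n = r + m * w" "1 \<le> r" "r \<le> w + 1"
  shows "dominator_wins_within G b (Suc m) {} {}"
proof -
  have "b * (2 * k + 1) \<ge> 2 * k + 1"
    using mult_le_mono1[OF \<open>b \<ge> 1\<close>, of "2 * k + 1"] by (simp only: mult_1)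
  then have w: "w + 1 = b * (2 * k + 1)" "w \<ge> 2 * k" using \<open>k \<ge> 1\<close> by (auto simp: w_def)
  then have "w \<ge> 1" using \<open>k \<ge> 1\<close> by simp
  define B where "B j = {r + j * w + 1..r + j * w + w}" for j
  have BV: "r + j * w + w \<le> n" if "j < m" for j
    using mult_le_mono1[of "Suc j" m w] that n by simp
  have block: "B j \<subseteq> pverts G \<and> B j \<noteq> {} \<and>
      (\<exists>X Y. X \<subseteq> B j \<and> Y \<subseteq> B j \<and> X \<inter> Y = {} \<and> card X \<le> b \<and> card Y \<le> b \<and>
        (\<forall>v \<in> B j. v \<in> X \<or> (\<exists>u \<in> X. (v, u) \<in> parcs G)) \<and>
        (\<forall>v \<in> B j. v \<in> Y \<or> (\<exists>u \<in> Y. (v, u) \<in> parcs G)))" if "j \<in> {..<m}" for j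
  proof -
    have j: "j < m" using that by simp
    \<comment> \<open>Starts \<open>k\<close> and \<open>k + 1\<close> both dominate the block;
      start \<open>k\<close> just suffices because \<open>w\<close> is one less than
      \<open>b * (2 * k + 1)\<close>.\<close>
    let ?C = "\<lambda>c. (\<lambda>i. r + j * w + min w (c + i * (2 * k + 1))) ` {..<b}"
    have C: "?C c \<subseteq> B j" "card (?C c) \<le> b"
      "\<forall>v \<in> B j. v \<in> ?C c \<or> (\<exists>u \<in> ?C c. (v, u) \<in> parcs G)" if "c \<in> {k, k + 1}" for c
      unfolding B_def
      by (rule centres_dominate[OF V near]; use that w BV[OF j] \<open>k \<ge> 1\<close> \<open>w \<ge> 1\<close> in auto)+
    \<comment> \<open>The last centre is at most \<open>b * (2 * k + 1) - k \<le> w\<close>, so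
      clamping never merges the two families, whose centres differ by one modulo
      \<open>2 * k + 1\<close>.\<close>
    have unclamped: "c + i * (2 * k + 1) \<le> w" if "c \<le> k + 1" "i < b" for c i
      using mult_le_mono1[of "Suc i" b "2 * k + 1"] that w \<open>k \<ge> 1\<close> by simp
    have "?C k \<inter> ?C (k + 1) = {}"
    proof (rule ccontr)
      assume "?C k \<inter> ?C (k + 1) \<noteq> {}"
      then obtain i i' where "i < b" "i' < b"
        "min w (k + i * (2 * k + 1)) = min w (k + 1 + i' * (2 * k + 1))" by auto
      then have "i * (2 * k + 1) = 1 + i' * (2 * k + 1)"
        using unclamped[of k i] unclamped[of "k + 1" i'] by simp
      then have "(2 * k + 1) dvd 1"
        by (metis dvd_add_left_iff dvd_triv_right)
      then show False using \<open>k \<ge> 1\<close> by simp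
    qed
    moreover have "B j \<subseteq> pverts G" "B j \<noteq> {}" using BV[OF j] V \<open>w \<ge> 1\<close> by (auto simp: B_def)
    ultimately show ?thesis using C[of k] C[of "k + 1"] by blast
  qed
  have disj: "disjoint_family_on B {..<m}"
  proof -
    have "B i \<inter> B j = {}" if "i < j" for i j
      using mult_le_mono1[of "Suc i" j w] that by (auto simp: B_def)
    then show ?thesis unfolding disjoint_family_on_def by (metis Int_commute nat_neq_iff)
  qed
  \<comment> \<open>The opening turn needs no second set, since Staller holds nothing yet; hence
    \<open>r\<close> may be as large as \<open>w + 1\<close>.\<close>
  define X where "X = (\<lambda>i. 0 + min r (k + 1 + i * (2 * k + 1))) ` {..<b}"
  have X: "X \<subseteq> {0 + 1..0 + r}" "card X \<le> b"
    "\<forall>v \<in> {0 + 1..0 + r}. v \<in> X \<or> (\<exists>u \<in> X. (v, u) \<in> parcs G)"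
    unfolding X_def by (rule centres_dominate[OF V near]; use n w in auto)+
  have XV: "X \<subseteq> pverts G" using X(1) V n by auto
  have dom: "v \<in> X \<or> (\<exists>u \<in> X. (v, u) \<in> parcs G)"
    if v: "v \<in> pverts G" "v \<notin> (\<Union>j\<in>{..<m}. B j)" for v
  proof (cases "v \<le> r")
    case True
    then show ?thesis using X(3) v V by auto
  next
    case False
    define j where "j = (v - r - 1) div w"
    have "v - r - 1 < m * w" using v(1) V n False by auto
    then have "j < m" unfolding j_def by (simp add: less_mult_imp_div_less)
    have "j * w \<le> v - r - 1" unfolding j_def by (rule div_times_less_eq_dividend)
    moreover have "v - r - 1 < j * w + w"
      unfolding j_def using \<open>w \<ge> 1\<close> dividend_less_div_times[of w] by (simp add: add.commute)
    ultimately have "v \<in> B j" using False by (auto simp: B_def)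
    then show ?thesis using v(2) \<open>j < m\<close> by blast
  qed
  have XB: "X \<inter> (\<Union>j\<in>{..<m}. B j) = {}" using X(1) by (fastforce simp: B_def)
  have step: "dominator_wins_within G b m X {y}" for y
    by (rule dominator_wins_blocks[of "{..<m}" m B G b X "{y}" y, OF _ _ disj block XV XB _ dom]) auto
  show ?thesis
  proof (cases "m = 0")
    case True
    then have "contains_dominating_set G X" using dom XV by (simp add: contains_dominating_set_iff)
    then show ?thesis using XV X(2) by auto
  next
    case False
    have "r + 1 \<in> pverts G" using BV[of 0] False V \<open>w \<ge> 1\<close> by simp
    then have "pverts G - X \<noteq> {}" using X(1) by auto
    then show ?thesis using step XV X(2) by auto
  qed
qed

section \<open>The exact value for both graphs\<close>

lemma gamma_MB_eq_ceiling:
  assumes V: "pverts G = {1..n}" and "b \<ge> 1" "k \<ge> 1" "n \<ge> 2"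
    and near: "\<And>u v. u \<in> {1..n} \<Longrightarrow> v \<in> {1..n} \<Longrightarrow> u \<noteq> v \<Longrightarrow> u \<le> v + k \<Longrightarrow> v \<le> u + k \<Longrightarrow>
      (u, v) \<in> parcs G"
    and offset: "\<And>u v. (u, v) \<in> parcs G \<Longrightarrow> \<exists>j. \<bar>j\<bar> \<le> int k \<and> v = cyc n (int u + j)"
  shows "gamma_MB G b = enat (nat \<lceil>(real n - 1) / (real b * (2 * real k + 1) - 1)\<rceil>)"
proof -
  define w where "w = b * (2 * k + 1) - 1"
  have "b * (2 * k + 1) \<ge> 2 * k + 1"
    using mult_le_mono1[OF \<open>b \<ge> 1\<close>, of "2 * k + 1"] by (simp only: mult_1)
  then have w: "w + 1 = b * (2 * k + 1)" "w \<ge> 1" using \<open>k \<ge> 1\<close> by (auto simp: w_def)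
  \<comment> \<open>Dividing \<open>n - 2\<close> gives \<open>n - 1 = m * w + (r - 1)\<close> with
    \<open>1 \<le> r - 1 \<le> w\<close>, so the ceiling is \<open>m + 1\<close> even when
    \<open>w\<close> divides \<open>n - 1\<close>.\<close>
  define m where "m = (n - 2) div w"
  define r where "r = (n - 2) mod w + 2"
  have n: "n = r + m * w" using \<open>n \<ge> 2\<close> div_mult_mod_eq[of "n - 2" w] by (simp add: m_def r_def)
  have "(n - 2) mod w < w" using w by simp
  then have r: "2 \<le> r" "r \<le> w + 1" by (auto simp: r_def)
  have "gamma_MB G b = enat (Suc m)"
    unfolding gamma_MB_def
  proof (rule antisym)
    have "dominator_wins_within G b (Suc m) {} {}"
      using n r unfolding w_def
      by (intro dominator_wins_interval[OF V near \<open>k \<ge> 1\<close> \<open>b \<ge> 1\<close>]) auto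
    then show "Inf {enat m |m. dominator_wins_within G b m {} {}} \<le> enat (Suc m)"
      by (intro Inf_lower) blast
    have "m < m'" if "dominator_wins_within G b m' {} {}" for m'
    proof -
      have "n \<le> m' * w + 1"
        using dominator_wins_within_imp_le[OF V _ \<open>b \<ge> 1\<close> offset that] \<open>n \<ge> 2\<close> unfolding w_def by simp
      then have "m * w < m' * w" using n r by linarith
      then show ?thesis by simp
    qed
    then show "enat (Suc m) \<le> Inf {enat m |m. dominator_wins_within G b m {} {}}"
      by (intro Inf_greatest) (auto simp: Suc_le_eq)
  qed
  moreover have "\<lceil>(real n - 1) / (real b * (2 * real k + 1) - 1)\<rceil> = int (Suc m)"
  proof -
    have "real b * (2 * real k + 1) = real (w + 1)" unfolding w(1) by (simp add: algebra_simps)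
    then have "real b * (2 * real k + 1) - 1 = real w" by simp
    moreover have "real n - 1 = real m * real w + (real r - 1)" unfolding n by simp
    ultimately show ?thesis
      using w(2) r by (intro ceiling_unique) (auto simp: field_simps)
  qed
  ultimately show ?thesis by simp
qed

theorem theorem1p4:
  fixes b k n :: nat
  assumes "b \<ge> 1" and "k \<ge> 1" and "n \<ge> 2" and "b \<le> n" and "k \<le> n"
  shows "gamma_MB (graph_power (path_graph n) k) b
           = enat (nat \<lceil>(real n - 1) / (real b * (2 * real k + 1) - 1)\<rceil>)
       \<and> gamma_MB (graph_power (cycle_graph n) k) b
           = enat (nat \<lceil>(real n - 1) / (real b * (2 * real k + 1) - 1)\<rceil>)"
proof -
  \<comment> \<open>Both graphs lie between path and cycle: the arcs of the path suffice for
    Dominator's strategy, and those of the cycle limit what she can dominate.\<close>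
  have "gamma_MB (graph_power G k) b
      = enat (nat \<lceil>(real n - 1) / (real b * (2 * real k + 1) - 1)\<rceil>)"
    if "pair_graph G" and G: "pverts G = {1..n}" "parcs (path_graph n) \<subseteq> parcs G"
      "parcs G \<subseteq> parcs (cycle_graph n)" for G
  proof (rule gamma_MB_eq_ceiling)
    interpret pair_graph G by fact
    have wf: "pair_wf_digraph G" by unfold_locales
    show "pverts (graph_power G k) = {1..n}" using G by (simp add: graph_power_def)
    show "(u, v) \<in> parcs (graph_power G k)"
      if "u \<in> {1..n}" "v \<in> {1..n}" "u \<noteq> v" "u \<le> v + k" "v \<le> u + k" for u v
      using G(2) by (intro graph_power_near_adj[OF wf G(1) _ _ that]) (auto simp: path_graph_def)
    have wrap: "cyc n (int n + 1) = 1" "cyc n 0 = n"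
      using \<open>n \<ge> 2\<close> by (auto simp: cyc_def zmod_minus1)
    have step: "\<exists>j. \<bar>j\<bar> \<le> 1 \<and> v = cyc n (int u + j)" if "(u, v) \<in> parcs G" for u v
    proof -
      have "(u, v) \<in> parcs (cycle_graph n)" using that G(3) by blast
      then consider "v = u + 1" "v \<in> {1..n}" | "u = v + 1" "v \<in> {1..n}" | "u = n" "v = 1" | "u = 1" "v = n"
        by (auto simp: cycle_graph_def path_graph_def)
      then show ?thesis
      proof cases
        case 1
        then show ?thesis using cyc_of_vertex[of v n] by (intro exI[of _ 1]) (simp add: add.commute)
      next
        case 2
        then show ?thesis using cyc_of_vertex[of v n] by (intro exI[of _ "- 1"]) simp
      next
        case 3
        then show ?thesis using wrap by (intro exI[of _ 1]) simp
      next
        case 4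
        then show ?thesis using wrap by (intro exI[of _ "- 1"]) simp
      qed
    qed
    show "\<exists>j. \<bar>j\<bar> \<le> int k \<and> v = cyc n (int u + j)" if "(u, v) \<in> parcs (graph_power G k)" for u v
      by (rule graph_power_adj_imp_offset[OF wf G(1) step that])
  qed (use assms in auto)
  from this[OF pair_graph_path_graph] this[OF pair_graph_cycle_graph[OF \<open>n \<ge> 2\<close>]]
  show ?thesis by (auto simp: cycle_graph_def path_graph_def)
qed

end
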